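(* Let $T=(V,E)$ be a directed tree, let $\lambda=\{\lambda_v\}_{v\in V}$ be a sequence of positive numbers and let $1\le p<\infty$. Assume the shift $S:\mathbf{L}^p(T,\lambda)\to\mathbf{L}^p(T,\lambda)$ is bounded. If $T$ has a root, then $S$ is not hypercyclic.
   Context: A directed graph $T=(V,E)$ consists of a countably infinite set $V$ of vertices and a set $E\subseteq V\times V$ of directed edges; it is always assumed locally finite (every vertex has finite indegree and finite outdegree). $T$ is a directed tree if it has no directed circuits (including loops $(v,v)$), its underlying undirected graph is connected, and every vertex has indegree $0$ or $1$. A root is a vertex of indegree $0$ (there is at most one, denoted $\mathrm{root}$; it need not exist). For $v\ne\mathrm{root}$, the parent $\operatorname{par}(v)$ is the unique $u$ with $(u,v)\in E$. $\mathbf{L}^p(T,\lambda)$ is the complex Banach space of functions $f:V\to\mathbb{C}$ with $\|f\|_p=\big(\sum_{v\in V}|f(v)|^p\lambda_v\big)^{1/p}<\infty$. The shift $S$ is defined by $(Sf)(v)=f(\operatorname{par}(v))$ if $v\neq\mathrm{root}$ and $(Sf)(\mathrm{root})=0$ (if there is a root). A bounded operator $A$ on a Banach space $\mathcal{B}$ is hypercyclic if there is $x\in\mathcal{B}$ such that $\{A^nx: n=0,1,2,\dots\}$ is dense in $\mathcal{B}$. *)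

theory Defs
  imports "HOL-Analysis.Analysis"
begin

section \<open>Directed trees\<close>

definition indegree :: "('v \<times> 'v) set \<Rightarrow> 'v \<Rightarrow> nat" where
  "indegree E v = card {u. (u, v) \<in> E}"

text \<open>Local finiteness is part of the notion of a directed graph here.\<close>

locale directed_graph =
  fixes V :: "'v set" and E :: "('v \<times> 'v) set"
  assumes countable_V: "countable V"
    and infinite_V: "infinite V"
    and E_subset: "E \<subseteq> V \<times> V"
    and finite_in: "v \<in> V \<Longrightarrow> finite {u. (u, v) \<in> E}"
    and finite_out: "v \<in> V \<Longrightarrow> finite {w. (v, w) \<in> E}"

locale directed_tree = directed_graph V E
  for V :: "'v set" and E :: "('v \<times> 'v) set" +
  assumes no_circuits: "acyclic E"
    and connected_undirected: "u \<in> V \<Longrightarrow> v \<in> V \<Longrightarrow> (u, v) \<in> (E \<union> E\<inverse>)\<^sup>*"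
    and indegree_0_or_1: "v \<in> V \<Longrightarrow> indegree E v = 0 \<or> indegree E v = 1"

definition is_root :: "'v set \<Rightarrow> ('v \<times> 'v) set \<Rightarrow> 'v \<Rightarrow> bool" where
  "is_root V E v \<longleftrightarrow> v \<in> V \<and> indegree E v = 0"

text \<open>Meaningful only for vertices of indegree 1.\<close>

definition par :: "('v \<times> 'v) set \<Rightarrow> 'v \<Rightarrow> 'v" where
  "par E v = (THE u. (u, v) \<in> E)"

section \<open>The weighted space and the shift\<close>

text \<open>
  A function on the vertex set is represented by a total function that vanishes off \<open>V\<close>,
  so that equality of representatives is equality on \<open>V\<close>.
\<close>

definition Lp_space :: "'v set \<Rightarrow> ('v \<Rightarrow> real) \<Rightarrow> real \<Rightarrow> ('v \<Rightarrow> complex) set" where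
  "Lp_space V w p =
     {f. (\<forall>v. v \<notin> V \<longrightarrow> f v = 0) \<and> (\<lambda>v. norm (f v) powr p * w v) summable_on V}"

definition Lp_norm :: "'v set \<Rightarrow> ('v \<Rightarrow> real) \<Rightarrow> real \<Rightarrow> ('v \<Rightarrow> complex) \<Rightarrow> real" where
  "Lp_norm V w p f = (\<Sum>\<^sub>\<infinity>v\<in>V. norm (f v) powr p * w v) powr (1 / p)"

definition shift :: "'v set \<Rightarrow> ('v \<times> 'v) set \<Rightarrow> ('v \<Rightarrow> complex) \<Rightarrow> 'v \<Rightarrow> complex" where
  "shift V E f v = (if v \<in> V \<and> \<not> is_root V E v then f (par E v) else 0)"

section \<open>Bounded and hypercyclic operators\<close>

text \<open>
  In the next two definitions \<open>B\<close> is the carrier of a space of complex-valued functions, with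
  pointwise operations, and \<open>N\<close> is its norm.
\<close>

definition bounded_operator_on ::
    "('v \<Rightarrow> complex) set \<Rightarrow> (('v \<Rightarrow> complex) \<Rightarrow> real) \<Rightarrow>
     (('v \<Rightarrow> complex) \<Rightarrow> ('v \<Rightarrow> complex)) \<Rightarrow> bool" where
  "bounded_operator_on B N A \<longleftrightarrow>
     (\<forall>f\<in>B. A f \<in> B) \<and>
     (\<forall>f\<in>B. \<forall>g\<in>B. \<forall>a b. A (\<lambda>v. a * f v + b * g v) = (\<lambda>v. a * A f v + b * A g v)) \<and>
     (\<exists>C. \<forall>f\<in>B. N (A f) \<le> C * N f)"

definition hypercyclic_on ::
    "('v \<Rightarrow> complex) set \<Rightarrow> (('v \<Rightarrow> complex) \<Rightarrow> real) \<Rightarrow>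
     (('v \<Rightarrow> complex) \<Rightarrow> ('v \<Rightarrow> complex)) \<Rightarrow> bool" where
  "hypercyclic_on B N A \<longleftrightarrow>
     (\<exists>x\<in>B. \<forall>y\<in>B. \<forall>\<epsilon>>0. \<exists>n. N (\<lambda>v. (A ^^ n) x v - y v) < \<epsilon>)"

text \<open>
  The linearity clause of \<^const>\<open>bounded_operator_on\<close> is no restriction for the shift:
\<close>

lemma shift_linear:
  "shift V E (\<lambda>v. a * f v + b * g v) = (\<lambda>v. a * shift V E f v + b * shift V E g v)"
  by (auto simp: shift_def)

end

theory Submission
  imports Defs
begin

text \<open>
  Every iterate \<open>S\<^sup>n x\<close> with \<open>n \<ge> 1\<close> vanishes at the root \<open>r\<close>, so the orbit of \<open>x\<close> takes at most the
  two values \<open>0\<close> and \<open>x r\<close> there. One of \<open>\<plusminus>1\<close> is at distance at least \<open>1\<close> from both values, and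
  evaluation at \<open>r\<close> is continuous, so the corresponding multiple of the point mass at \<open>r\<close> is
  bounded away from the orbit.
\<close>

text \<open>A single term of a sum of nonnegative terms is at most the whole sum. For
  \<open>w v > 0\<close> this is continuity of evaluation at \<open>v\<close>.\<close>

lemma point_eval_le_Lp_norm:
  assumes f: "f \<in> Lp_space V w p" and w: "\<And>v. v \<in> V \<Longrightarrow> w v \<ge> 0" and p: "p > 0" and v: "v \<in> V"
  shows "norm (f v) * w v powr (1 / p) \<le> Lp_norm V w p f"
proof -
  have "(\<lambda>u. norm (f u) powr p * w u) summable_on V"
    using f by (simp add: Lp_space_def)
  then have "(\<Sum>u\<in>{v}. norm (f u) powr p * w u) \<le> (\<Sum>\<^sub>\<infinity>u\<in>V. norm (f u) powr p * w u)"
    by (rule finite_sum_le_infsum) (use v w in auto)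
  then have "(norm (f v) powr p * w v) powr (1 / p) \<le> Lp_norm V w p f"
    unfolding Lp_norm_def using w[OF v] p by (intro powr_mono2) auto
  then show ?thesis
    using w[OF v] p by (simp add: powr_mult powr_powr)
qed

text \<open>Only one term of the series changes, so summability is unaffected.\<close>

lemma Lp_space_update:
  assumes f: "f \<in> Lp_space V w p" and v: "v \<in> V"
  shows "f(v := c) \<in> Lp_space V w p"
proof -
  have "(\<lambda>u. norm (f u) powr p * w u) summable_on V - {v}"
    using f by (auto simp: Lp_space_def intro: summable_on_subset_banach)
  then have "(\<lambda>u. norm ((f(v := c)) u) powr p * w u) summable_on V - {v}"
    by (rule summable_on_cong[THEN iffD1, rotated]) simp
  then have "(\<lambda>u. norm ((f(v := c)) u) powr p * w u) summable_on insert v (V - {v})"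
    by (simp only: summable_on_insert_iff)
  then show ?thesis
    using f v by (auto simp: Lp_space_def insert_absorb)
qed

lemma funpow_shift_root:
  assumes "is_root V E r" and "n > 0"
  shows "(shift V E ^^ n) f r = 0"
  using assms by (cases n) (auto simp: shift_def)

theorem proposition3p3:
  fixes V :: "'v set" and E :: "('v \<times> 'v) set"
    and w :: "'v \<Rightarrow> real" and p :: real
  assumes "directed_tree V E"
    and "\<And>v. v \<in> V \<Longrightarrow> w v > 0"
    and "1 \<le> p"
    and "bounded_operator_on (Lp_space V w p) (Lp_norm V w p) (shift V E)"
    and "\<exists>r. is_root V E r"
  shows "\<not> hypercyclic_on (Lp_space V w p) (Lp_norm V w p) (shift V E)"
proof
  assume "hypercyclic_on (Lp_space V w p) (Lp_norm V w p) (shift V E)"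
  then obtain x where x: "x \<in> Lp_space V w p"
    and dense: "\<And>y \<epsilon>. y \<in> Lp_space V w p \<Longrightarrow> \<epsilon> > 0 \<Longrightarrow>
      \<exists>n. Lp_norm V w p (\<lambda>v. (shift V E ^^ n) x v - y v) < \<epsilon>"
    unfolding hypercyclic_on_def by blast
  obtain r where r: "is_root V E r"
    using assms(5) by blast
  then have rV: "r \<in> V"
    by (simp add: is_root_def)
  have orbit: "(shift V E ^^ n) x \<in> Lp_space V w p" for n
    using x assms(4) by (induction n) (auto simp: bounded_operator_on_def)
  \<comment> \<open>The sign is chosen against that of \<open>Re (x r)\<close>, so that the real
    part of \<open>x r - c\<close> already has absolute value at least 1.\<close>
  define c :: complex where "c = (if Re (x r) \<le> 0 then 1 else -1)"
  have "norm (x r - c) \<ge> 1"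
    using abs_Re_le_cmod[of "x r - c"] by (auto simp: c_def split: if_splits)
  moreover have "norm (0 - c) \<ge> 1"
    by (simp add: c_def)
  ultimately have far: "norm ((shift V E ^^ n) x r - c) \<ge> 1" for n
    using funpow_shift_root[OF r, of n x] by (cases n) auto
  define y where "y = (\<lambda>v. 0 :: complex)(r := c)"
  have "y \<in> Lp_space V w p"
    unfolding y_def using rV by (intro Lp_space_update) (simp_all add: Lp_space_def)
  \<comment> \<open>The radius is the least norm that point evaluation allows for a function of
    modulus at least 1 at \<open>r\<close>.\<close>
  then obtain n where n: "Lp_norm V w p (\<lambda>v. (shift V E ^^ n) x v - y v) < w r powr (1 / p)"
    using dense assms(2)[OF rV] by fastforce
  \<comment> \<open>Subtracting \<open>y\<close> changes the orbit element only at \<open>r\<close>,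
    so membership follows without closure of the space under differences.\<close>
  have "(\<lambda>v. (shift V E ^^ n) x v - y v) =
      ((shift V E ^^ n) x)(r := (shift V E ^^ n) x r - c)"
    by (auto simp: y_def)
  then have "(\<lambda>v. (shift V E ^^ n) x v - y v) \<in> Lp_space V w p"
    using Lp_space_update[OF orbit rV] by simp
  then have "norm ((shift V E ^^ n) x r - y r) * w r powr (1 / p)
      \<le> Lp_norm V w p (\<lambda>v. (shift V E ^^ n) x v - y v)"
    by (rule point_eval_le_Lp_norm) (use assms(2,3) rV less_imp_le in auto)
  moreover have "w r powr (1 / p) \<le> norm ((shift V E ^^ n) x r - y r) * w r powr (1 / p)"
    using far[of n] mult_right_mono[OF far, of "w r powr (1 / p)"] by (simp add: y_def)
  ultimately show False
    using n by linarith
qed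

end
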